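(* Let $(S,\mathbf{P})$, $(\omega,\mathbb{P})$ and $\{H_{N,\omega}\}_N$ be as described in the context; in particular the Basic Hypothesis holds and the free energy $f$ exists. Let $Z_{N,\omega}=\mathbf{E}[\exp(H_{N,\omega}(S))]$ and let $$\tilde f := \liminf_{N\to\infty}\frac1N\log\mathbb{E}\big[Z_{N,\omega}\big]\in[0,\infty]$$ be the annealed free energy. If $\tilde f>0$, then for every local bounded measurable function $F:\Gamma^{\mathbb{N}}\to\mathbb{R}$ such that $\mathbb{E}[F(\omega)]=0$ one has $$\liminf_{N\to\infty}\frac1N\log\mathbb{E}\,\mathbf{E}\left[\exp\left(H_{N,\omega}(S)+\sum_{n=0}^{N}F(\theta_n\omega)\right)\right]>0,$$ where $(\theta_n\omega)_m=\omega_{n+m}$.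
   Context: $\mathbb{N}=\{1,2,\ldots\}$ and $d\in\mathbb{N}$. Process: $S=\{S_n\}_{n=0,1,\ldots}$ is a stochastic process with $S_n$ taking values in $\mathbb{Z}^d$, with law $\mathbf{P}$ and expectation $\mathbf{E}$. Disorder: $\omega=\{\omega_n\}_{n\in\mathbb{N}}$ is a sequence of IID random variables with law $\mathbb{P}$ and expectation $\mathbb{E}$, taking values in $\Gamma\subseteq\mathbb{R}$. Under $\mathbb{E}\,\mathbf{E}$, $\omega$ and $S$ are independent with laws $\mathbb{P}$ and $\mathbf{P}$. Hamiltonian: for each $N$, $H_{N,\omega}(S)$ is a function of $\omega$ and of the trajectory $S$, depending on $S$ only through $S_0,S_1,\ldots,S_N$, and measurable in $(\omega,S)$. The value $-\infty$ is allowed (with $e^{-\infty}=0$). The partition function is $Z_{N,\omega}:=\mathbf{E}[\exp(H_{N,\omega}(S))]$. Basic Hypothesis: there exists a sequence $\{D_n\}_n$ of subsets of $\mathbb{Z}^d$ such that $$\lim_{N\to\infty}\frac1N\log\mathbf{P}\left(S_n\in D_n\text{ for }n=1,2,\ldots,N\right)=0,$$ and such that $H_{N,\omega}(S)=0$ whenever $S_n\in D_n$ for $n=1,2,\ldots,N$. Existence of the free energy: $\{(1/N)\log Z_{N,\omega}\}_N$ is a sequence of integrable random variables that converges in $L^1(\mathbb{P})$ and $\mathbb{P}$-almost surely to a constant $f$, called the (quenched) free energy. A function $F:\Gamma^{\mathbb{N}}\to\mathbb{R}$ is local if it depends only on finitely many coordinates of $\omega$. *)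

theory Defs
  imports "HOL-Probability.Probability"
begin

(* exp : [-oo,oo] -> [0,oo] and log : [0,oo] -> [-oo,oo].  The real-valued ln cannot be used for
   the free energies, since ln 0 = 0 in HOL. *)

definition exp_ereal :: "ereal \<Rightarrow> ennreal" where
  "exp_ereal x = (if x = \<infinity> then \<infinity> else if x = -\<infinity> then 0 else ennreal (exp (real_of_ereal x)))"

definition ln_ennreal :: "ennreal \<Rightarrow> ereal" where
  "ln_ennreal x = (if x = \<infinity> then \<infinity> else if x = 0 then -\<infinity> else ereal (ln (enn2real x)))"

(* (1/N) log x; its value at N = 0 is immaterial *)
definition log_rate :: "nat \<Rightarrow> ennreal \<Rightarrow> ereal" where
  "log_rate N x = ereal (1 / real N) * ln_ennreal x"

(* Disorder sequences are indexed by {1, 2, ...}: elements of Gamma^{1,2,...} are functions on nat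
   that are undefined at 0, as usual for PiM.  The set Gamma need not be Borel; it carries the
   trace of the Borel sigma-algebra. *)

definition disorder_space :: "real set \<Rightarrow> (nat \<Rightarrow> real) measure" where
  "disorder_space \<Gamma> = (\<Pi>\<^sub>M n\<in>{1..}. restrict_space borel \<Gamma>)"

definition path_space :: "(nat \<Rightarrow> int ^ 'd) measure" where
  "path_space = (\<Pi>\<^sub>M n\<in>UNIV. count_space UNIV)"

definition disorder_seq :: "(nat \<Rightarrow> 'a \<Rightarrow> real) \<Rightarrow> 'a \<Rightarrow> nat \<Rightarrow> real" where
  "disorder_seq \<omega> x = (\<lambda>n\<in>{1..}. \<omega> n x)"

definition trajectory :: "(nat \<Rightarrow> 'b \<Rightarrow> int ^ 'd) \<Rightarrow> 'b \<Rightarrow> nat \<Rightarrow> int ^ 'd" where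
  "trajectory S y = (\<lambda>n. S n y)"

definition disorder_shift :: "nat \<Rightarrow> (nat \<Rightarrow> real) \<Rightarrow> nat \<Rightarrow> real" where
  "disorder_shift n w = (\<lambda>m\<in>{1..}. w (n + m))"

definition stochastic_process :: "'b measure \<Rightarrow> (nat \<Rightarrow> 'b \<Rightarrow> int ^ 'd) \<Rightarrow> bool" where
  "stochastic_process P S \<longleftrightarrow> prob_space P \<and> (\<forall>n. S n \<in> measurable P (count_space UNIV))"

definition iid_disorder :: "'a measure \<Rightarrow> real set \<Rightarrow> (nat \<Rightarrow> 'a \<Rightarrow> real) \<Rightarrow> bool" where
  "iid_disorder Q \<Gamma> \<omega> \<longleftrightarrow>
     prob_space Q \<and>
     prob_space.indep_vars Q (\<lambda>_. restrict_space borel \<Gamma>) \<omega> {1..} \<and>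
     (\<forall>n\<ge>1. distr Q (restrict_space borel \<Gamma>) (\<omega> n) = distr Q (restrict_space borel \<Gamma>) (\<omega> 1))"

definition hamiltonian ::
  "real set \<Rightarrow> (nat \<Rightarrow> (nat \<Rightarrow> real) \<Rightarrow> (nat \<Rightarrow> int ^ 'd) \<Rightarrow> ereal) \<Rightarrow> bool" where
  "hamiltonian \<Gamma> H \<longleftrightarrow>
     (\<forall>N\<ge>1.
        (\<lambda>(w, s). H N w s) \<in> borel_measurable (disorder_space \<Gamma> \<Otimes>\<^sub>M path_space) \<and>
        (\<forall>w\<in>space (disorder_space \<Gamma>). \<forall>s. H N w s < \<infinity>) \<and>
        (\<forall>w\<in>space (disorder_space \<Gamma>). \<forall>s s'. (\<forall>n\<le>N. s n = s' n) \<longrightarrow> H N w s = H N w s'))"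

definition basic_hypothesis ::
  "'b measure \<Rightarrow> (nat \<Rightarrow> 'b \<Rightarrow> int ^ 'd) \<Rightarrow> real set \<Rightarrow>
   (nat \<Rightarrow> (nat \<Rightarrow> real) \<Rightarrow> (nat \<Rightarrow> int ^ 'd) \<Rightarrow> ereal) \<Rightarrow> bool" where
  "basic_hypothesis P S \<Gamma> H \<longleftrightarrow>
     (\<exists>D :: nat \<Rightarrow> (int ^ 'd) set.
        (\<lambda>N. log_rate N (emeasure P {y \<in> space P. \<forall>n\<in>{1..N}. S n y \<in> D n})) \<longlonglongrightarrow> 0 \<and>
        (\<forall>N\<ge>1. \<forall>w\<in>space (disorder_space \<Gamma>). \<forall>s. (\<forall>n\<in>{1..N}. s n \<in> D n) \<longrightarrow> H N w s = 0))"

definition partition_function ::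
  "'b measure \<Rightarrow> (nat \<Rightarrow> 'b \<Rightarrow> int ^ 'd) \<Rightarrow>
   (nat \<Rightarrow> (nat \<Rightarrow> real) \<Rightarrow> (nat \<Rightarrow> int ^ 'd) \<Rightarrow> ereal) \<Rightarrow> nat \<Rightarrow> (nat \<Rightarrow> real) \<Rightarrow> ennreal" where
  "partition_function P S H N w = (\<integral>\<^sup>+ y. exp_ereal (H N w (trajectory S y)) \<partial>P)"

(* The finite-volume free energies are a priori extended real; integrability includes that they
   are almost surely finite. *)
definition is_free_energy ::
  "'a measure \<Rightarrow> (nat \<Rightarrow> 'a \<Rightarrow> real) \<Rightarrow> 'b measure \<Rightarrow> (nat \<Rightarrow> 'b \<Rightarrow> int ^ 'd) \<Rightarrow>
   (nat \<Rightarrow> (nat \<Rightarrow> real) \<Rightarrow> (nat \<Rightarrow> int ^ 'd) \<Rightarrow> ereal) \<Rightarrow> real \<Rightarrow> bool" where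
  "is_free_energy Q \<omega> P S H f \<longleftrightarrow>
     (let X = (\<lambda>N x. log_rate N (partition_function P S H N (disorder_seq \<omega> x))) in
       (\<forall>N\<ge>1. (AE x in Q. \<bar>X N x\<bar> \<noteq> \<infinity>) \<and> integrable Q (\<lambda>x. real_of_ereal (X N x))) \<and>
       (\<lambda>N. \<integral>x. \<bar>real_of_ereal (X N x) - f\<bar> \<partial>Q) \<longlonglongrightarrow> 0 \<and>
       (AE x in Q. (\<lambda>N. X N x) \<longlonglongrightarrow> ereal f))"

definition annealed_free_energy ::
  "'a measure \<Rightarrow> (nat \<Rightarrow> 'a \<Rightarrow> real) \<Rightarrow> 'b measure \<Rightarrow> (nat \<Rightarrow> 'b \<Rightarrow> int ^ 'd) \<Rightarrow>
   (nat \<Rightarrow> (nat \<Rightarrow> real) \<Rightarrow> (nat \<Rightarrow> int ^ 'd) \<Rightarrow> ereal) \<Rightarrow> ereal" where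
  "annealed_free_energy Q \<omega> P S H =
     liminf (\<lambda>N. log_rate N (\<integral>\<^sup>+ x. partition_function P S H N (disorder_seq \<omega> x) \<partial>Q))"

definition local_function :: "real set \<Rightarrow> ((nat \<Rightarrow> real) \<Rightarrow> real) \<Rightarrow> bool" where
  "local_function \<Gamma> F \<longleftrightarrow>
     (\<exists>J. finite J \<and> J \<subseteq> {1..} \<and>
        (\<forall>w\<in>space (disorder_space \<Gamma>). \<forall>w'\<in>space (disorder_space \<Gamma>).
           (\<forall>j\<in>J. w j = w' j) \<longrightarrow> F w = F w'))"

end

theory Submission
  imports Defs
begin

text \<open>
  Write \<open>T\<^sub>n\<close> for the sum of \<open>F\<close> over the first \<open>n\<close> shifts of the disorder. The constrained
  annealed partition function \<open>E[Z\<^sub>N exp T\<^sub>N\<^sub>+\<^sub>1]\<close> grows exponentially for one of two reasons,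
  according to whether the fluctuations of \<open>T\<^sub>n\<close> are genuine or not.

  Let \<open>k\<close> be a window length such that \<open>F\<close> depends on the coordinates \<open>1, \<dots>, k\<close> only.
  Fix \<open>p\<close>, cut the coordinates into blocks of length \<open>p\<close>, and average \<open>T\<^sub>m\<^sub>p\<close> over the first \<open>k\<close>
  coordinates of every block. A window of length \<open>k\<close> meets at most one of the remaining block
  interiors, so the average splits into a sum of \<open>m\<close> independent copies of a single centred
  variable \<open>g\<^sub>p\<close> (\<open>block_mean\<close>), and Jensen's inequality gives
  \<open>E[exp T\<^sub>m\<^sub>p] \<ge> E[exp g\<^sub>p]\<^sup>m\<close>. If some \<open>g\<^sub>p\<close> is not almost surely zero, then
  \<open>E[exp g\<^sub>p] > 1\<close> by strict convexity and \<open>E[exp T\<^sub>n]\<close> grows exponentially. If, on the other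
  hand, every \<open>g\<^sub>p\<close> vanishes, then \<open>T\<^sub>p\<close> equals the difference between itself and its
  average; only the at most \<open>2k\<close> windows at the two ends of the block contribute to it, so
  \<open>T\<^sub>p\<close> is bounded uniformly in \<open>p\<close>. This is \<open>birkhoff_sum_dichotomy\<close>.

  In the first case the path may be confined to the sets \<open>D\<^sub>n\<close>, where the Hamiltonian vanishes:
  this costs no exponential rate, and the growth of \<open>E[exp T\<^sub>n]\<close> survives. In the second case
  the extra factor \<open>exp T\<^sub>N\<^sub>+\<^sub>1\<close> is bounded below by a positive constant, and the growth is
  that of the annealed partition function, whose rate is positive by assumption. The
  non-negativity of the annealed free energy is again confinement to \<open>D\<^sub>n\<close>.
\<close>

section \<open>Resampling and shifting an independent sequence\<close>

(* The index set of the product measures is written {1..} throughout; this keeps the simplifier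
   from rewriting it to {Suc 0..}. *)
declare One_nat_def [simp del]

locale iid_sequence =
  fixes \<mu> :: "real measure"
  assumes prob_space_coordinate: "prob_space \<mu>"
begin

abbreviation law :: "(nat \<Rightarrow> real) measure" where
  "law \<equiv> \<Pi>\<^sub>M n\<in>{1..}. \<mu>"

sublocale law: prob_space law
  by (intro prob_space_PiM prob_space_coordinate)

sublocale pair: pair_sigma_finite law law ..

end

text \<open>
  The sequence \<open>x\<close> is kept on \<open>I\<close> and replaced by \<open>y\<close> elsewhere. Integrating over an independent
  copy \<open>y\<close> then is conditioning on the coordinates in \<open>I\<close>, within one fixed product space and
  without conditional expectations.
\<close>

definition resample :: "nat set \<Rightarrow> (nat \<Rightarrow> real) \<Rightarrow> (nat \<Rightarrow> real) \<Rightarrow> nat \<Rightarrow> real" where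
  "resample I x y = (\<lambda>n\<in>{1..}. if n \<in> I then x n else y n)"

lemma disorder_shift_disorder_shift:
  "disorder_shift b (disorder_shift a x) = disorder_shift (a + b) x"
  by (auto simp: disorder_shift_def restrict_def ac_simps)

context iid_sequence
begin

lemma measurable_resample [measurable]:
  "(\<lambda>z. resample I (fst z) (snd z)) \<in> measurable (law \<Otimes>\<^sub>M law) law"
  unfolding resample_def by measurable

lemma measurable_resample_right:
  assumes "x \<in> space law"
  shows "resample I x \<in> measurable law law"
  using measurable_compose[OF measurable_Pair1'[OF assms, of law] measurable_resample[of I]] by simp

lemma resample_in_space:
  assumes "x \<in> space law" "y \<in> space law"
  shows "resample I x y \<in> space law"
  using measurable_space[OF measurable_resample_right] assms by blast

lemma measurable_disorder_shift [measurable]: "disorder_shift p \<in> measurable law law"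
  unfolding disorder_shift_def
  by (intro measurable_restrict measurable_component_singleton) auto

lemma disorder_shift_in_space:
  assumes "x \<in> space law"
  shows "disorder_shift p x \<in> space law"
  using measurable_space[OF measurable_disorder_shift] assms by blast

lemma distr_resample: "distr (law \<Otimes>\<^sub>M law) law (\<lambda>z. resample I (fst z) (snd z)) = law"
proof -
  interpret P: product_prob_space "\<lambda>_::nat. \<mu>" "{1..}"
    by (simp add: product_prob_space_def product_prob_space_axioms_def product_sigma_finite_def
        prob_space_coordinate prob_space_imp_sigma_finite)
  show ?thesis
  proof (rule P.PiM_eq)
    fix J :: "nat set" and A
    assume J: "finite J" "J \<subseteq> {1..}" and A: "\<And>j. j \<in> J \<Longrightarrow> A j \<in> sets \<mu>"
    let ?cyl = "\<lambda>K. prod_emb {1..} (\<lambda>_. \<mu>) K (\<Pi>\<^sub>E j\<in>K. A j)"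
    have cyl: "?cyl K \<in> sets law" if "K \<subseteq> J" for K
      using J A that by (intro sets_PiM_I) (auto intro: finite_subset)
    have eq: "(\<lambda>z. resample I (fst z) (snd z)) -` ?cyl J \<inter> space (law \<Otimes>\<^sub>M law)
        = ?cyl (J \<inter> I) \<times> ?cyl (J - I)"
    proof -
      have "1 \<le> j" if "j \<in> J" for j using J that by auto
      then show ?thesis
        using J by (auto simp: prod_emb_def space_pair_measure space_PiM resample_def PiE_iff
            Pi_iff extensional_def restrict_def split: if_splits)
    qed
    have "emeasure (distr (law \<Otimes>\<^sub>M law) law (\<lambda>z. resample I (fst z) (snd z))) (?cyl J)
        = emeasure law (?cyl (J \<inter> I)) * emeasure law (?cyl (J - I))"
      by (simp add: emeasure_distr cyl eq law.emeasure_pair_measure_Times)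
    also have "\<dots> = (\<Prod>j\<in>J \<inter> I. emeasure \<mu> (A j)) * (\<Prod>j\<in>J - I. emeasure \<mu> (A j))"
      using J A by (subst (1 2) P.emeasure_PiM_emb) auto
    also have "\<dots> = (\<Prod>j\<in>J. emeasure \<mu> (A j))"
      using prod.Int_Diff[OF J(1), of "\<lambda>j. emeasure \<mu> (A j)" I] by simp
    finally show "emeasure (distr (law \<Otimes>\<^sub>M law) law (\<lambda>z. resample I (fst z) (snd z))) (?cyl J)
        = (\<Prod>j\<in>J. emeasure \<mu> (A j))" .
  qed simp
qed

lemma distr_disorder_shift: "distr law law (disorder_shift p) = law"
  unfolding disorder_shift_def
  by (rule distr_PiM_reindex[where M = "\<lambda>_. \<mu>"]) (auto simp: prob_space_coordinate)

lemma nn_integral_resample: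
  assumes [measurable]: "G \<in> borel_measurable law"
  shows "(\<integral>\<^sup>+ x. \<integral>\<^sup>+ y. G (resample I x y) \<partial>law \<partial>law) = (\<integral>\<^sup>+ x. G x \<partial>law)"
proof -
  have "(\<integral>\<^sup>+ x. G x \<partial>law) = (\<integral>\<^sup>+ z. G (resample I (fst z) (snd z)) \<partial>(law \<Otimes>\<^sub>M law))"
    by (subst (1) distr_resample[of I, symmetric]) (simp add: nn_integral_distr)
  also have "\<dots> = (\<integral>\<^sup>+ x. \<integral>\<^sup>+ y. G (resample I x y) \<partial>law \<partial>law)"
    by (subst law.nn_integral_fst[symmetric]) auto
  finally show ?thesis ..
qed

lemma integral_resample:
  fixes G :: "(nat \<Rightarrow> real) \<Rightarrow> real"
  assumes G: "integrable law G"
  shows "(\<integral>x. \<integral>y. G (resample I x y) \<partial>law \<partial>law) = (\<integral>x. G x \<partial>law)"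
proof -
  have "integrable (law \<Otimes>\<^sub>M law) (\<lambda>z. G (resample I (fst z) (snd z)))"
    using G by (intro integrable_distr[OF measurable_resample]) (simp add: distr_resample)
  then have "(\<integral>x. \<integral>y. G (resample I x y) \<partial>law \<partial>law)
      = (\<integral>z. G (resample I (fst z) (snd z)) \<partial>(law \<Otimes>\<^sub>M law))"
    by (subst pair.integral_fst'[symmetric]) auto
  also have "\<dots> = (\<integral>x. G x \<partial>law)"
    using G by (subst (3) distr_resample[of I, symmetric]) (simp add: integral_distr)
  finally show ?thesis .
qed

lemma integral_disorder_shift:
  fixes G :: "(nat \<Rightarrow> real) \<Rightarrow> real"
  assumes [measurable]: "G \<in> borel_measurable law"
  shows "(\<integral>x. G (disorder_shift p x) \<partial>law) = (\<integral>x. G x \<partial>law)"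
  by (subst (2) distr_disorder_shift[of p, symmetric]) (simp add: integral_distr)

lemma nn_integral_disorder_shift:
  assumes [measurable]: "G \<in> borel_measurable law"
  shows "(\<integral>\<^sup>+ x. G (disorder_shift p x) \<partial>law) = (\<integral>\<^sup>+ x. G x \<partial>law)"
  by (subst (2) distr_disorder_shift[of p, symmetric]) (simp add: nn_integral_distr)

text \<open>
  A function of the first \<open>p\<close> coordinates is independent of the sequence shifted by \<open>p\<close>:
  resampling all coordinates after \<open>p\<close> feeds independent arguments to the two factors.
\<close>

lemma nn_integral_mult_disorder_shift:
  assumes [measurable]: "g \<in> borel_measurable law" "h \<in> borel_measurable law"
    and loc: "\<And>x y. x \<in> space law \<Longrightarrow> y \<in> space law \<Longrightarrow> (\<And>j. j \<in> {1..p} \<Longrightarrow> x j = y j) \<Longrightarrow> g x = g y"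
  shows "(\<integral>\<^sup>+ x. g x * h (disorder_shift p x) \<partial>law) = (\<integral>\<^sup>+ x. g x \<partial>law) * (\<integral>\<^sup>+ x. h x \<partial>law)"
proof -
  have "(\<integral>\<^sup>+ x. g x * h (disorder_shift p x) \<partial>law)
      = (\<integral>\<^sup>+ x. \<integral>\<^sup>+ y. g (resample {1..p} x y) * h (disorder_shift p (resample {1..p} x y)) \<partial>law \<partial>law)"
    by (subst nn_integral_resample) auto
  also have "\<dots> = (\<integral>\<^sup>+ x. \<integral>\<^sup>+ y. g x * h (disorder_shift p y) \<partial>law \<partial>law)"
  proof (intro nn_integral_cong arg_cong2[where f = "(*)"])
    fix x y assume x: "x \<in> space law" and y: "y \<in> space law"
    show "g (resample {1..p} x y) = g x"
      using x y by (intro loc resample_in_space) (auto simp: resample_def)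
    have "disorder_shift p (resample {1..p} x y) = disorder_shift p y"
      by (auto simp: disorder_shift_def resample_def restrict_def)
    then show "h (disorder_shift p (resample {1..p} x y)) = h (disorder_shift p y)" by simp
  qed
  also have "\<dots> = (\<integral>\<^sup>+ x. g x \<partial>law) * (\<integral>\<^sup>+ x. h x \<partial>law)"
    by (simp add: nn_integral_cmult nn_integral_multc nn_integral_disorder_shift)
  finally show ?thesis .
qed

lemma nn_integral_prod_disorder_shift:
  assumes [measurable]: "g \<in> borel_measurable law"
    and loc: "\<And>x y. x \<in> space law \<Longrightarrow> y \<in> space law \<Longrightarrow> (\<And>j. j \<in> {1..p} \<Longrightarrow> x j = y j) \<Longrightarrow> g x = g y"
  shows "(\<integral>\<^sup>+ x. (\<Prod>i<m. g (disorder_shift (i * p) x)) \<partial>law) = (\<integral>\<^sup>+ x. g x \<partial>law) ^ m"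
proof (induction m)
  case 0
  then show ?case by (simp add: law.emeasure_space_1)
next
  case (Suc m)
  have "(\<integral>\<^sup>+ x. (\<Prod>i<Suc m. g (disorder_shift (i * p) x)) \<partial>law)
      = (\<integral>\<^sup>+ x. g x * (\<Prod>i<m. g (disorder_shift (i * p) (disorder_shift p x))) \<partial>law)"
  proof (rule nn_integral_cong)
    fix x assume x: "x \<in> space law"
    have "disorder_shift 0 x = x"
      using x by (auto simp: disorder_shift_def space_PiM PiE_iff extensional_def restrict_def)
    moreover have "disorder_shift (Suc i * p) x = disorder_shift (i * p) (disorder_shift p x)" for i
      by (auto simp: disorder_shift_def restrict_def ac_simps)
    ultimately show "(\<Prod>i<Suc m. g (disorder_shift (i * p) x))
        = g x * (\<Prod>i<m. g (disorder_shift (i * p) (disorder_shift p x)))"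
      by (subst prod.lessThan_Suc_shift) (simp del: mult_Suc)
  qed
  also have "\<dots> = (\<integral>\<^sup>+ x. g x \<partial>law) * (\<integral>\<^sup>+ x. g x \<partial>law) ^ m"
    by (subst nn_integral_mult_disorder_shift) (auto simp: Suc intro: loc)
  finally show ?case by simp
qed

end

section \<open>Exponential moments\<close>

text \<open>
  Jensen's inequality for the exponential, from its tangent line at the mean.
\<close>

lemma (in prob_space) exp_expectation_le:
  fixes X :: "'a \<Rightarrow> real"
  assumes X: "integrable M X"
  shows "ennreal (exp (expectation X)) \<le> (\<integral>\<^sup>+ x. ennreal (exp (X x)) \<partial>M)"
proof -
  define c where "c = expectation X"
  define u where "u x = exp c * (1 + (X x - c))" for x
  have u: "integrable M u" unfolding u_def using X by simp
  have "expectation u = exp c"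
    unfolding u_def using X by (simp add: prob_space c_def)
  moreover have "expectation u \<le> expectation (\<lambda>x. max 0 (u x))"
    using u by (intro integral_mono) auto
  ultimately have "ennreal (exp c) \<le> ennreal (expectation (\<lambda>x. max 0 (u x)))"
    by (intro ennreal_leI) simp
  also have "\<dots> = (\<integral>\<^sup>+ x. ennreal (max 0 (u x)) \<partial>M)"
    using u by (subst nn_integral_eq_integral) auto
  also have "\<dots> \<le> (\<integral>\<^sup>+ x. ennreal (exp (X x)) \<partial>M)"
  proof (intro nn_integral_mono ennreal_leI)
    fix x
    have "u x \<le> exp c * exp (X x - c)"
      unfolding u_def by (intro mult_left_mono exp_ge_add_one_self) auto
    then show "max 0 (u x) \<le> exp (X x)" by (simp flip: exp_add)
  qed
  finally show ?thesis unfolding c_def .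
qed

text \<open>
  The gap \<open>exp X - (1 + X)\<close> is non-negative and vanishes only where \<open>X = 0\<close>, so its mean is
  positive.
\<close>

lemma (in prob_space) expectation_exp_gt_one:
  fixes X :: "'a \<Rightarrow> real"
  assumes X: "integrable M X" "integrable M (\<lambda>x. exp (X x))"
    and mean: "expectation X = 0" and nontrivial: "\<not> (AE x in M. X x = 0)"
  shows "1 < expectation (\<lambda>x. exp (X x))"
proof (rule ccontr)
  assume *: "\<not> 1 < expectation (\<lambda>x. exp (X x))"
  let ?r = "\<lambda>x. exp (X x) - (1 + X x)"
  have r: "integrable M ?r" using X by simp
  have nonneg: "0 \<le> ?r x" for x using exp_ge_add_one_self[of "X x"] by simp
  have "expectation ?r = expectation (\<lambda>x. exp (X x)) - 1"
    using X mean by (simp add: prob_space)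
  with * have "expectation ?r = 0"
    using Bochner_Integration.integral_nonneg[of M ?r] nonneg by fastforce
  then have "AE x in M. ?r x = 0"
    using integral_nonneg_eq_0_iff_AE[OF r] nonneg by simp
  moreover have "X x = 0" if "?r x = 0" for x
  proof -
    have "ln (exp (X x)) = exp (X x) - 1" using that unfolding ln_exp by linarith
    then have "exp (X x) = 1" by (rule ln_eq_minus_one[OF exp_gt_zero])
    then show ?thesis by simp
  qed
  ultimately have "AE x in M. X x = 0" by (rule eventually_mono)
  with nontrivial show False ..
qed


section \<open>Sums of a local observable along the shift\<close>

locale local_observable = iid_sequence +
  fixes F :: "(nat \<Rightarrow> real) \<Rightarrow> real" and k :: nat and B :: real
  assumes measurable_F [measurable]: "F \<in> borel_measurable law"
    and local: "\<And>x y. x \<in> space law \<Longrightarrow> y \<in> space law \<Longrightarrow>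
      (\<And>j. j \<in> {1..k} \<Longrightarrow> x j = y j) \<Longrightarrow> F x = F y"
    and bounded: "\<And>x. x \<in> space law \<Longrightarrow> \<bar>F x\<bar> \<le> B"
    and centered: "(\<integral>x. F x \<partial>law) = 0"
begin

definition birkhoff_sum :: "nat \<Rightarrow> (nat \<Rightarrow> real) \<Rightarrow> real" where
  "birkhoff_sum n x = (\<Sum>j<n. F (disorder_shift j x))"

text \<open>
  The conditional expectation of the sum over a block of length \<open>p\<close> given the coordinates
  \<open>k+1, \<dots>, p\<close>. The last windows of the block reach into the first \<open>k\<close> coordinates of the next
  block, which is why those are the ones averaged out: the variables obtained from successive
  blocks are then independent.
\<close>

definition block_mean :: "nat \<Rightarrow> (nat \<Rightarrow> real) \<Rightarrow> real" where
  "block_mean p x = (\<integral>y. birkhoff_sum p (resample {k<..p} x y) \<partial>law)"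

lemma bound_nonneg: "0 \<le> B"
proof -
  obtain x where "x \<in> space law" using law.not_empty by blast
  then show ?thesis using bounded[of x] by linarith
qed

lemma measurable_birkhoff_sum [measurable]: "birkhoff_sum n \<in> borel_measurable law"
  unfolding birkhoff_sum_def by measurable

lemma birkhoff_sum_add:
  "birkhoff_sum (a + b) x = birkhoff_sum a x + birkhoff_sum b (disorder_shift a x)"
  unfolding birkhoff_sum_def disorder_shift_disorder_shift by (induction b) auto

lemma abs_birkhoff_sum_le:
  assumes "x \<in> space law"
  shows "\<bar>birkhoff_sum n x\<bar> \<le> real n * B"
proof -
  have "\<bar>birkhoff_sum n x\<bar> \<le> (\<Sum>j<n. \<bar>F (disorder_shift j x)\<bar>)"
    unfolding birkhoff_sum_def by (rule sum_abs)
  also have "\<dots> \<le> (\<Sum>j<n. B)"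
    using assms by (intro sum_mono bounded disorder_shift_in_space)
  finally show ?thesis by simp
qed

lemma integrable_bounded:
  fixes G :: "(nat \<Rightarrow> real) \<Rightarrow> real"
  assumes "G \<in> borel_measurable law" "\<And>x. x \<in> space law \<Longrightarrow> \<bar>G x\<bar> \<le> C"
  shows "integrable law G"
  using assms by (intro law.integrable_const_bound[where B = C]) auto

lemma integrable_birkhoff_sum: "integrable law (birkhoff_sum n)"
  by (rule integrable_bounded[OF _ abs_birkhoff_sum_le]) auto

lemma integral_birkhoff_sum: "(\<integral>x. birkhoff_sum n x \<partial>law) = 0"
proof -
  have "integrable law (\<lambda>x. F (disorder_shift j x))" for j
    by (rule integrable_bounded[OF _ bounded[OF disorder_shift_in_space]]) auto
  then show ?thesis
    unfolding birkhoff_sum_def by (simp add: integral_disorder_shift centered)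
qed

lemma integrable_birkhoff_sum_resample:
  assumes x: "x \<in> space law"
  shows "integrable law (\<lambda>y. birkhoff_sum n (resample I x y))"
  using x by (intro integrable_bounded[where C = "real n * B"]
      measurable_compose[OF measurable_resample_right] abs_birkhoff_sum_le resample_in_space) auto

lemma measurable_block_mean [measurable]: "block_mean p \<in> borel_measurable law"
proof -
  have "(\<lambda>(x, y). birkhoff_sum p (resample {k<..p} x y)) \<in> borel_measurable (law \<Otimes>\<^sub>M law)"
    using measurable_compose[OF measurable_resample measurable_birkhoff_sum]
    by (simp add: case_prod_unfold)
  then show ?thesis
    unfolding block_mean_def by (rule law.borel_measurable_lebesgue_integral)
qed

lemma abs_block_mean_le:
  assumes x: "x \<in> space law"
  shows "\<bar>block_mean p x\<bar> \<le> real p * B"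
proof -
  have "\<bar>block_mean p x\<bar> \<le> (\<integral>y. \<bar>birkhoff_sum p (resample {k<..p} x y)\<bar> \<partial>law)"
    unfolding block_mean_def by (rule integral_abs_bound)
  also have "\<dots> \<le> (\<integral>y. real p * B \<partial>law)"
    using x by (intro integral_mono integrable_abs integrable_birkhoff_sum_resample
        abs_birkhoff_sum_le resample_in_space) auto
  finally show ?thesis by (simp add: law.prob_space)
qed

lemma integral_block_mean: "(\<integral>x. block_mean p x \<partial>law) = 0"
  unfolding block_mean_def
  by (simp add: integral_resample integrable_birkhoff_sum integral_birkhoff_sum)

lemma block_mean_cong:
  assumes "\<And>j. j \<in> {1..p} \<Longrightarrow> x j = y j"
  shows "block_mean p x = block_mean p y"
proof -
  have "resample {k<..p} x z = resample {k<..p} y z" for z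
    using assms by (auto simp: resample_def restrict_def)
  then show ?thesis unfolding block_mean_def by simp
qed

text \<open>
  Here \<open>I\<close> is the union of the block interiors. The windows starting in the block number \<open>m\<close> end
  before the interior of the next block begins, so inside them \<open>I\<close> looks like the single interior
  \<open>{k<..p}\<close> shifted by \<open>m * p\<close>.
\<close>

lemma integral_birkhoff_sum_resample:
  assumes x: "x \<in> space law" and p: "0 < p"
  defines "I \<equiv> {n. \<exists>i. i * p + k < n \<and> n \<le> (i + 1) * p}"
  shows "(\<integral>y. birkhoff_sum (m * p) (resample I x y) \<partial>law)
    = (\<Sum>i<m. block_mean p (disorder_shift (i * p) x))"
proof (induction m)
  case 0
  then show ?case by (simp add: birkhoff_sum_def)
next
  case (Suc m)
  let ?shift = "disorder_shift (m * p)"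
  have split_block: "birkhoff_sum p (?shift (resample I x y))
      = birkhoff_sum p (resample {k<..p} (?shift x) (?shift y))" if y: "y \<in> space law" for y
    unfolding birkhoff_sum_def
  proof (intro sum.cong refl local)
    fix j l assume j: "j \<in> {..<p}" and l: "l \<in> {1..k}"
    have "m * p + (j + l) \<in> I \<longleftrightarrow> j + l \<in> {k<..p}"
    proof
      assume "m * p + (j + l) \<in> I"
      then obtain i where i: "i * p + k < m * p + (j + l)" "m * p + (j + l) \<le> (i + 1) * p"
        unfolding I_def by blast
      have "i = m"
      proof (rule linorder_cases[of i m])
        assume "i < m"
        then have "(i + 1) * p \<le> m * p" by (intro mult_right_mono) auto
        with i(2) have "m * p + (j + l) \<le> m * p" by (rule order_trans)
        then show ?thesis using l by simp
      next
        assume "m < i"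
        then have "(m + 1) * p \<le> i * p" by (intro mult_right_mono) auto
        then have "m * p + p \<le> i * p" by (simp only: distrib_right mult_1)
        moreover have "m * p + (j + l) < m * p + p + k" using j l by simp
        ultimately show ?thesis using i(1) by linarith
      qed
      then show "j + l \<in> {k<..p}" using i by (simp add: distrib_right)
    next
      assume "j + l \<in> {k<..p}"
      then show "m * p + (j + l) \<in> I" unfolding I_def by (auto simp: distrib_right intro!: exI[of _ m])
    qed
    then show "disorder_shift j (?shift (resample I x y)) l
        = disorder_shift j (resample {k<..p} (?shift x) (?shift y)) l"
      using l by (simp add: disorder_shift_def resample_def)
  qed (use x y in \<open>auto intro!: disorder_shift_in_space resample_in_space\<close>)
  have meas: "(\<lambda>y. birkhoff_sum p (resample {k<..p} (?shift x) y)) \<in> borel_measurable law"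
    using x by (intro measurable_compose[OF measurable_resample_right] disorder_shift_in_space) auto
  have int: "integrable law (\<lambda>y. birkhoff_sum p (?shift (resample I x y)))"
    using x by (intro integrable_bounded[where C = "real p * B"] abs_birkhoff_sum_le
        disorder_shift_in_space resample_in_space
        measurable_compose[OF measurable_resample_right]) auto
  have "(\<integral>y. birkhoff_sum (Suc m * p) (resample I x y) \<partial>law)
      = (\<integral>y. birkhoff_sum (m * p) (resample I x y) \<partial>law)
        + (\<integral>y. birkhoff_sum p (?shift (resample I x y)) \<partial>law)"
    unfolding mult_Suc add.commute[of p] birkhoff_sum_add
    by (rule Bochner_Integration.integral_add[OF integrable_birkhoff_sum_resample[OF x] int])
  also have "(\<integral>y. birkhoff_sum p (?shift (resample I x y)) \<partial>law)
      = (\<integral>y. birkhoff_sum p (resample {k<..p} (?shift x) (?shift y)) \<partial>law)"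
    by (intro Bochner_Integration.integral_cong refl split_block)
  also have "\<dots> = block_mean p (?shift x)"
    unfolding block_mean_def by (rule integral_disorder_shift[OF meas])
  finally show ?case using Suc by simp
qed

text \<open>
  The inequality loses no constant factor, which is what makes it useful: a single block length
  with nontrivial mean already forces exponential growth.
\<close>

lemma exp_block_mean_power_le:
  assumes p: "0 < p"
  shows "(\<integral>\<^sup>+ x. ennreal (exp (block_mean p x)) \<partial>law) ^ m
    \<le> (\<integral>\<^sup>+ x. ennreal (exp (birkhoff_sum (m * p) x)) \<partial>law)"
proof -
  let ?I = "{n. \<exists>i. i * p + k < n \<and> n \<le> (i + 1) * p}"
  have "(\<integral>\<^sup>+ x. ennreal (exp (block_mean p x)) \<partial>law) ^ m
      = (\<integral>\<^sup>+ x. (\<Prod>i<m. ennreal (exp (block_mean p (disorder_shift (i * p) x)))) \<partial>law)"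
    by (subst nn_integral_prod_disorder_shift) (auto intro: block_mean_cong)
  also have "\<dots> = (\<integral>\<^sup>+ x. ennreal (exp (\<integral>y. birkhoff_sum (m * p) (resample ?I x y) \<partial>law)) \<partial>law)"
    by (intro nn_integral_cong, subst integral_birkhoff_sum_resample[OF _ p])
      (auto simp: prod_ennreal exp_sum)
  also have "\<dots> \<le> (\<integral>\<^sup>+ x. \<integral>\<^sup>+ y. ennreal (exp (birkhoff_sum (m * p) (resample ?I x y))) \<partial>law \<partial>law)"
    by (intro nn_integral_mono law.exp_expectation_le integrable_birkhoff_sum_resample)
  also have "\<dots> = (\<integral>\<^sup>+ x. ennreal (exp (birkhoff_sum (m * p) x)) \<partial>law)"
    by (rule nn_integral_resample) measurable
  finally show ?thesis .
qed

text \<open>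
  Only windows that stick out of \<open>{k<..p}\<close> see a difference. These start among the first \<open>k\<close> or
  the last \<open>k\<close> positions, and each of them contributes at most \<open>2 * B\<close>.
\<close>

lemma abs_birkhoff_sum_diff_le:
  assumes x: "x \<in> space law" and z: "z \<in> space law"
    and eq: "\<And>n. n \<in> {k<..p} \<Longrightarrow> x n = z n"
  shows "\<bar>birkhoff_sum p x - birkhoff_sum p z\<bar> \<le> 4 * real k * B"
proof -
  let ?d = "\<lambda>j. F (disorder_shift j x) - F (disorder_shift j z)"
  have inner: "?d j = 0" if "j < p" "k \<le> j" "j + k \<le> p" for j
  proof -
    have "F (disorder_shift j x) = F (disorder_shift j z)"
      using x z that by (intro local disorder_shift_in_space) (auto simp: disorder_shift_def intro!: eq)
    then show ?thesis by simp
  qed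
  have "birkhoff_sum p x - birkhoff_sum p z = (\<Sum>j<p. ?d j)"
    unfolding birkhoff_sum_def by (simp add: sum_subtractf)
  also have "\<dots> = (\<Sum>j\<in>{..<p} \<inter> ({..<k} \<union> {p - k..<p}). ?d j)"
  proof (intro sum.mono_neutral_right ballI)
    fix j assume "j \<in> {..<p} - {..<p} \<inter> ({..<k} \<union> {p - k..<p})"
    then show "?d j = 0" by (intro inner) auto
  qed auto
  finally have "\<bar>birkhoff_sum p x - birkhoff_sum p z\<bar>
      \<le> (\<Sum>j\<in>{..<p} \<inter> ({..<k} \<union> {p - k..<p}). \<bar>?d j\<bar>)"
    by (simp only: sum_abs)
  also have "\<dots> \<le> real (card ({..<p} \<inter> ({..<k} \<union> {p - k..<p}))) * (2 * B)"
  proof (rule sum_bounded_above)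
    fix j
    show "\<bar>?d j\<bar> \<le> 2 * B"
      using bounded[OF disorder_shift_in_space[OF x], of j]
        bounded[OF disorder_shift_in_space[OF z], of j] by linarith
  qed
  also have "\<dots> \<le> real (2 * k) * (2 * B)"
  proof (intro mult_right_mono of_nat_mono)
    have "card ({..<p} \<inter> ({..<k} \<union> {p - k..<p})) \<le> card ({..<k} \<union> {p - k..<p})"
      by (intro card_mono) auto
    also have "\<dots> \<le> card {..<k} + card {p - k..<p}" by (rule card_Un_le)
    finally show "card ({..<p} \<inter> ({..<k} \<union> {p - k..<p})) \<le> 2 * k" by simp
  qed (use bound_nonneg in auto)
  finally show ?thesis by simp
qed

lemma birkhoff_sum_bounded_of_block_mean_zero:
  assumes "AE x in law. block_mean p x = 0"
  shows "AE x in law. \<bar>birkhoff_sum p x\<bar> \<le> 4 * real k * B"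
  using assms AE_space
proof eventually_elim
  case (elim x)
  let ?z = "\<lambda>y. resample {k<..p} x y"
  have diff: "\<bar>birkhoff_sum p x - birkhoff_sum p (?z y)\<bar> \<le> 4 * real k * B" if "y \<in> space law" for y
    using elim(2) that by (intro abs_birkhoff_sum_diff_le resample_in_space) (auto simp: resample_def)
  note int = integrable_birkhoff_sum_resample[OF elim(2), of p "{k<..p}"]
  have "birkhoff_sum p x = (\<integral>y. birkhoff_sum p x - birkhoff_sum p (?z y) \<partial>law)"
    using int elim(1) by (simp add: law.prob_space block_mean_def)
  then have "\<bar>birkhoff_sum p x\<bar> \<le> (\<integral>y. \<bar>birkhoff_sum p x - birkhoff_sum p (?z y)\<bar> \<partial>law)"
    by (metis integral_abs_bound)
  also have "\<dots> \<le> (\<integral>y. 4 * real k * B \<partial>law)"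
    using int by (intro integral_mono diff) auto
  finally show ?case by (simp add: law.prob_space)
qed

text \<open>
  Either exponential moments of the sums grow exponentially, or the sums stay bounded below; the
  latter happens when the observable has no asymptotic variance, as for a coboundary.
\<close>

lemma birkhoff_sum_dichotomy:
  obtains (growth) l C where "0 < l"
      "\<And>n. ennreal (exp (C + real n * l)) \<le> (\<integral>\<^sup>+ x. ennreal (exp (birkhoff_sum n x)) \<partial>law)"
    | (bounded_below) C where "\<And>n. AE x in law. C \<le> birkhoff_sum n x"
proof (cases "\<exists>p. \<not> (AE x in law. block_mean p x = 0)")
  case False
  then have "AE x in law. - (4 * real k * B) \<le> birkhoff_sum n x" for n
    using birkhoff_sum_bounded_of_block_mean_zero[of n] by (auto elim!: eventually_mono)
  then show ?thesis by (rule that(2))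
next
  case True
  then obtain p where nontrivial: "\<not> (AE x in law. block_mean p x = 0)" by blast
  have p: "0 < p"
    using nontrivial by (intro Nat.gr0I) (auto simp: block_mean_def birkhoff_sum_def)
  define a where "a = (\<integral>x. exp (block_mean p x) \<partial>law)"
  have int: "integrable law (block_mean p)"
    by (rule integrable_bounded[OF _ abs_block_mean_le]) auto
  have int_exp: "integrable law (\<lambda>x. exp (block_mean p x))"
    using abs_block_mean_le[of _ p]
    by (intro integrable_bounded[where C = "exp (real p * B)"]) (auto simp: abs_le_iff)
  have a: "1 < a"
    unfolding a_def
    by (rule law.expectation_exp_gt_one[OF int int_exp integral_block_mean nontrivial])
  have a_eq: "(\<integral>\<^sup>+ x. ennreal (exp (block_mean p x)) \<partial>law) = ennreal a"
    unfolding a_def by (rule nn_integral_eq_integral[OF int_exp]) auto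
  (* n contains at least n / p - 1 full blocks, each worth a factor a; the missing block costs
     ln a, and the incomplete one at most p * B. *)
  define l where "l = ln a / real p"
  define C where "C = - ln a - real p * B"
  have "ennreal (exp (C + real n * l)) \<le> (\<integral>\<^sup>+ x. ennreal (exp (birkhoff_sum n x)) \<partial>law)" for n
  proof -
    define m where "m = n div p"
    have n: "n = m * p + n mod p" unfolding m_def by simp
    have "real n \<le> real ((m + 1) * p)"
      using p n by (intro of_nat_mono) (metis add.commute add_le_cancel_left mod_less_divisor
          less_imp_le mult.commute mult_Suc_right Suc_eq_plus1)
    then have "real n / real p \<le> real m + 1"
      using p by (simp add: field_simps)
    then have "real n / real p * ln a \<le> (real m + 1) * ln a"
      using a by (intro mult_right_mono) auto
    then have "C + real n * l \<le> real m * ln a - real p * B"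
      unfolding C_def l_def by (simp add: algebra_simps)
    then have "exp (C + real n * l) \<le> exp (- (real p * B) + real m * ln a)"
      by simp
    also have "\<dots> = exp (- (real p * B)) * a ^ m"
      using a by (simp only: exp_add exp_of_nat_mult) simp
    finally have "ennreal (exp (C + real n * l)) \<le> ennreal (exp (- (real p * B)) * a ^ m)"
      by (rule ennreal_leI)
    also have "\<dots> = ennreal (exp (- (real p * B))) * (\<integral>\<^sup>+ x. ennreal (exp (block_mean p x)) \<partial>law) ^ m"
      using a by (simp add: a_eq ennreal_mult ennreal_power)
    also have "\<dots> \<le> ennreal (exp (- (real p * B)))
        * (\<integral>\<^sup>+ x. ennreal (exp (birkhoff_sum (m * p) x)) \<partial>law)"
      by (intro mult_left_mono exp_block_mean_power_le p) auto
    also have "\<dots> = (\<integral>\<^sup>+ x. ennreal (exp (- (real p * B)))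
        * ennreal (exp (birkhoff_sum (m * p) x)) \<partial>law)"
      by (subst nn_integral_cmult) auto
    also have "\<dots> \<le> (\<integral>\<^sup>+ x. ennreal (exp (birkhoff_sum n x)) \<partial>law)"
    proof (intro nn_integral_mono)
      fix x assume x: "x \<in> space law"
      have "\<bar>birkhoff_sum (n mod p) (disorder_shift (m * p) x)\<bar> \<le> real (n mod p) * B"
        by (intro abs_birkhoff_sum_le disorder_shift_in_space x)
      also have "\<dots> \<le> real p * B"
        using p bound_nonneg by (intro mult_right_mono) (auto simp: less_imp_le)
      finally have "- (real p * B) + birkhoff_sum (m * p) x \<le> birkhoff_sum n x"
        using birkhoff_sum_add[of "m * p" "n mod p" x] n by simp
      then show "ennreal (exp (- (real p * B))) * ennreal (exp (birkhoff_sum (m * p) x))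
          \<le> ennreal (exp (birkhoff_sum n x))"
        by (simp flip: ennreal_mult exp_add)
    qed
    finally show ?thesis .
  qed
  moreover have "0 < l" unfolding l_def using a p by simp
  ultimately show ?thesis using that(1) by blast
qed

end

section \<open>Exponential growth rates\<close>

lemma measurable_exp_ereal [measurable]: "exp_ereal \<in> borel_measurable borel"
  unfolding exp_ereal_def by measurable

lemma exp_ereal_add_ereal: "exp_ereal (h + ereal t) = exp_ereal h * ennreal (exp t)"
  by (cases h) (auto simp: exp_ereal_def ennreal_mult exp_add ennreal_top_mult)

lemma log_rate_mono:
  assumes "x \<le> y"
  shows "log_rate N x \<le> log_rate N y"
proof -
  have "ln_ennreal x \<le> ln_ennreal y"
    using assms
    by (cases x; cases y) (auto simp: ln_ennreal_def top_unique ennreal_eq_0_iff not_le)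
  then show ?thesis
    unfolding log_rate_def by (intro ereal_mult_left_mono) auto
qed

lemma log_rate_exp_mult:
  assumes "0 < N"
  shows "log_rate N (ennreal (exp c) * z) = ereal (c / real N) + log_rate N z"
proof (cases z)
  case top
  then show ?thesis
    using assms by (simp add: log_rate_def ln_ennreal_def ennreal_mult_top)
next
  case (real r)
  show ?thesis
  proof (cases "r = 0")
    case True
    with real assms show ?thesis by (simp add: log_rate_def ln_ennreal_def)
  next
    case False
    with real assms show ?thesis
      by (simp add: log_rate_def ln_ennreal_def ln_mult add_divide_distrib flip: ennreal_mult)
  qed
qed

text \<open>
  All three lower bounds on free energies are instances of this comparison: confinement of the path
  gives \<open>l = 0\<close> or the growth rate of the exponential moments, and a bounded density gives
  \<open>l = 0\<close> with \<open>z\<close> the annealed partition function.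
\<close>

lemma liminf_log_rate_ge:
  assumes le: "\<And>N. 0 < N \<Longrightarrow> ennreal (exp (C + real N * l)) * z N \<le> Z N"
  shows "ereal l + liminf (\<lambda>N. log_rate N (z N)) \<le> liminf (\<lambda>N. log_rate N (Z N))"
proof -
  have "(\<lambda>N. C / real N + l) \<longlonglongrightarrow> 0 + l" by (intro tendsto_add lim_const_over_n tendsto_const)
  then have "(\<lambda>N. ereal (C / real N + l)) \<longlonglongrightarrow> ereal l" by simp
  then have "ereal l + liminf (\<lambda>N. log_rate N (z N))
      = liminf (\<lambda>N. ereal (C / real N + l) + log_rate N (z N))"
    by (intro ereal_liminf_lim_add[symmetric]) auto
  also have "\<dots> \<le> liminf (\<lambda>N. log_rate N (Z N))"
  proof (rule Liminf_mono, rule eventually_sequentiallyI[of 1])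
    fix N :: nat assume N: "1 \<le> N"
    then have "ereal (C / real N + l) + log_rate N (z N)
        = log_rate N (ennreal (exp (C + real N * l)) * z N)"
      by (subst log_rate_exp_mult) (auto simp: add_divide_distrib)
    also have "\<dots> \<le> log_rate N (Z N)"
      using N by (intro log_rate_mono le) auto
    finally show "ereal (C / real N + l) + log_rate N (z N) \<le> log_rate N (Z N)" .
  qed
  finally show ?thesis .
qed

section \<open>Partition functions and the disorder\<close>

lemma measurable_trajectory:
  assumes "stochastic_process P S"
  shows "trajectory S \<in> measurable P path_space"
  using assms unfolding trajectory_def path_space_def stochastic_process_def
  by (intro measurable_PiM_single') auto

lemma emeasure_le_partition_function:
  assumes "\<And>s. (\<forall>n\<in>{1..N}. s n \<in> D n) \<Longrightarrow> H N w s = 0"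
  shows "emeasure P {y \<in> space P. \<forall>n\<in>{1..N}. S n y \<in> D n} \<le> partition_function P S H N w"
    (is "emeasure P ?A \<le> _")
proof (cases "?A \<in> sets P")
  case True
  then have "emeasure P ?A = (\<integral>\<^sup>+ y. indicator ?A y \<partial>P)" by simp
  also have "\<dots> \<le> partition_function P S H N w"
    unfolding partition_function_def
  proof (rule nn_integral_mono)
    fix y assume "y \<in> space P"
    show "indicator ?A y \<le> exp_ereal (H N w (trajectory S y))"
      using assms[of "trajectory S y"]
      by (auto simp: trajectory_def exp_ereal_def split: split_indicator)
  qed
  finally show ?thesis .
qed (simp add: emeasure_notin_sets)

lemma measurable_exp_hamiltonian:
  assumes "stochastic_process P S"
    and [measurable]: "disorder_seq \<omega> \<in> measurable Q (disorder_space \<Gamma>)"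
    and H: "(\<lambda>(w, s). H N w s) \<in> borel_measurable (disorder_space \<Gamma> \<Otimes>\<^sub>M path_space)"
  shows "(\<lambda>z. exp_ereal (H N (disorder_seq \<omega> (fst z)) (trajectory S (snd z))))
    \<in> borel_measurable (Q \<Otimes>\<^sub>M P)"
proof -
  note [measurable] = measurable_trajectory[OF assms(1)]
  have "(\<lambda>z. (disorder_seq \<omega> (fst z), trajectory S (snd z)))
      \<in> measurable (Q \<Otimes>\<^sub>M P) (disorder_space \<Gamma> \<Otimes>\<^sub>M path_space)" by measurable
  from measurable_compose[OF measurable_compose[OF this H] measurable_exp_ereal]
  show ?thesis by simp
qed

lemma measurable_partition_function:
  assumes "stochastic_process P S"
    and "disorder_seq \<omega> \<in> measurable Q (disorder_space \<Gamma>)"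
    and "(\<lambda>(w, s). H N w s) \<in> borel_measurable (disorder_space \<Gamma> \<Otimes>\<^sub>M path_space)"
  shows "(\<lambda>x. partition_function P S H N (disorder_seq \<omega> x)) \<in> borel_measurable Q"
proof -
  interpret P: prob_space P using assms(1) by (simp add: stochastic_process_def)
  show ?thesis
    unfolding partition_function_def using measurable_exp_hamiltonian[of P S \<omega> Q \<Gamma> H N, OF assms]
    by (intro P.borel_measurable_nn_integral) (simp add: case_prod_unfold)
qed

lemma nn_integral_exp_ereal_add:
  assumes "stochastic_process P S"
    and [measurable]: "disorder_seq \<omega> \<in> measurable Q (disorder_space \<Gamma>)"
    and H: "(\<lambda>(w, s). H N w s) \<in> borel_measurable (disorder_space \<Gamma> \<Otimes>\<^sub>M path_space)"
    and [measurable]: "T \<in> borel_measurable (disorder_space \<Gamma>)"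
  shows "(\<integral>\<^sup>+ z. exp_ereal (H N (disorder_seq \<omega> (fst z)) (trajectory S (snd z))
      + ereal (T (disorder_seq \<omega> (fst z)))) \<partial>(Q \<Otimes>\<^sub>M P))
    = (\<integral>\<^sup>+ x. partition_function P S H N (disorder_seq \<omega> x)
      * ennreal (exp (T (disorder_seq \<omega> x))) \<partial>Q)"
proof -
  interpret P: prob_space P using assms(1) by (simp add: stochastic_process_def)
  note joint = measurable_exp_hamiltonian[of P S \<omega> Q \<Gamma> H N, OF assms(1-3)]
  have meas: "(\<lambda>y. exp_ereal (H N (disorder_seq \<omega> x) (trajectory S y))) \<in> borel_measurable P"
    if x: "x \<in> space Q" for x
    using measurable_compose[OF measurable_Pair1'[OF x, of P] joint] by simp
  have "(\<lambda>z. ennreal (exp (T (disorder_seq \<omega> (fst z))))) \<in> borel_measurable (Q \<Otimes>\<^sub>M P)"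
    by measurable
  with joint have "(\<lambda>z. exp_ereal (H N (disorder_seq \<omega> (fst z)) (trajectory S (snd z)))
      * ennreal (exp (T (disorder_seq \<omega> (fst z))))) \<in> borel_measurable (Q \<Otimes>\<^sub>M P)"
    by (rule borel_measurable_times_ennreal)
  from P.nn_integral_fst[OF this] show ?thesis
    unfolding partition_function_def exp_ereal_add_ereal
    by (simp add: nn_integral_multc meas cong: nn_integral_cong_simp)
qed

lemma
  assumes "iid_disorder Q \<Gamma> \<omega>"
  shows measurable_disorder_seq: "disorder_seq \<omega> \<in> measurable Q (disorder_space \<Gamma>)"
    and distr_disorder_seq: "distr Q (disorder_space \<Gamma>) (disorder_seq \<omega>)
      = (\<Pi>\<^sub>M n\<in>{1..}. distr Q (restrict_space borel \<Gamma>) (\<omega> 1))"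
    and prob_space_distr_disorder: "prob_space (distr Q (restrict_space borel \<Gamma>) (\<omega> 1))"
proof -
  interpret Q: prob_space Q using assms by (simp add: iid_disorder_def)
  have indep: "Q.indep_vars (\<lambda>_. restrict_space borel \<Gamma>) \<omega> {1..}"
    and same: "\<And>n. 1 \<le> n \<Longrightarrow>
      distr Q (restrict_space borel \<Gamma>) (\<omega> n) = distr Q (restrict_space borel \<Gamma>) (\<omega> 1)"
    using assms unfolding iid_disorder_def by blast+
  have rv: "\<omega> n \<in> measurable Q (restrict_space borel \<Gamma>)" if "n \<in> {1..}" for n
    using indep that by (simp add: Q.indep_vars_def)
  show "disorder_seq \<omega> \<in> measurable Q (disorder_space \<Gamma>)"
    unfolding disorder_seq_def disorder_space_def using rv by (rule measurable_restrict)
  show "prob_space (distr Q (restrict_space borel \<Gamma>) (\<omega> 1))"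
    by (intro Q.prob_space_distr rv) simp
  have "distr Q (disorder_space \<Gamma>) (disorder_seq \<omega>)
      = (\<Pi>\<^sub>M n\<in>{1..}. distr Q (restrict_space borel \<Gamma>) (\<omega> n))"
    using indep rv unfolding disorder_space_def disorder_seq_def
    by (subst Q.indep_vars_iff_distr_eq_PiM'[symmetric]) auto
  also have "\<dots> = (\<Pi>\<^sub>M n\<in>{1..}. distr Q (restrict_space borel \<Gamma>) (\<omega> 1))"
    by (intro PiM_cong same) auto
  finally show "distr Q (disorder_space \<Gamma>) (disorder_seq \<omega>)
      = (\<Pi>\<^sub>M n\<in>{1..}. distr Q (restrict_space borel \<Gamma>) (\<omega> 1))" .
qed

section \<open>The constrained annealed bound\<close>

theorem proposition1p1:
  fixes Q :: "'a measure" and \<Gamma> :: "real set" and \<omega> :: "nat \<Rightarrow> 'a \<Rightarrow> real"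
    and P :: "'b measure" and S :: "nat \<Rightarrow> 'b \<Rightarrow> int ^ 'd"
    and H :: "nat \<Rightarrow> (nat \<Rightarrow> real) \<Rightarrow> (nat \<Rightarrow> int ^ 'd) \<Rightarrow> ereal"
    and f :: real
  assumes "stochastic_process P S"
    and "iid_disorder Q \<Gamma> \<omega>"
    and "hamiltonian \<Gamma> H"
    and "basic_hypothesis P S \<Gamma> H"
    and "is_free_energy Q \<omega> P S H f"
  shows "0 \<le> annealed_free_energy Q \<omega> P S H \<and>
    (annealed_free_energy Q \<omega> P S H > 0 \<longrightarrow>
      (\<forall>F :: (nat \<Rightarrow> real) \<Rightarrow> real.
        local_function \<Gamma> F \<and>
        bounded (F ` space (disorder_space \<Gamma>)) \<and>
        F \<in> borel_measurable (disorder_space \<Gamma>) \<and>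
        (\<integral>x. F (disorder_seq \<omega> x) \<partial>Q) = 0 \<longrightarrow>
        liminf (\<lambda>N. log_rate N (\<integral>\<^sup>+ z.
          exp_ereal (H N (disorder_seq \<omega> (fst z)) (trajectory S (snd z)) +
            ereal (\<Sum>n=0..N. F (disorder_shift n (disorder_seq \<omega> (fst z))))) \<partial>(Q \<Otimes>\<^sub>M P))) > 0))"
proof -
  interpret P: prob_space P using assms(1) by (simp add: stochastic_process_def)
  interpret Q: prob_space Q using assms(2) by (simp add: iid_disorder_def)
  note [measurable] = measurable_disorder_seq[OF assms(2)]
  have H_measurable: "(\<lambda>(w, s). H N w s) \<in> borel_measurable (disorder_space \<Gamma> \<Otimes>\<^sub>M path_space)"
    if "0 < N" for N
    using assms(3) that by (simp add: hamiltonian_def)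
  have seq_space: "disorder_seq \<omega> x \<in> space (disorder_space \<Gamma>)" if "x \<in> space Q" for x
    using measurable_space[OF measurable_disorder_seq[OF assms(2)] that] .
  obtain D :: "nat \<Rightarrow> (int ^ 'd) set" where
    D_rate: "(\<lambda>N. log_rate N (emeasure P {y \<in> space P. \<forall>n\<in>{1..N}. S n y \<in> D n})) \<longlonglongrightarrow> 0"
    and D_zero: "\<And>N w s. 1 \<le> N \<Longrightarrow> w \<in> space (disorder_space \<Gamma>) \<Longrightarrow>
      (\<forall>n\<in>{1..N}. s n \<in> D n) \<Longrightarrow> H N w s = 0"
    using assms(4) unfolding basic_hypothesis_def by blast
  define d where "d N = emeasure P {y \<in> space P. \<forall>n\<in>{1..N}. S n y \<in> D n}" for N
  define Z where "Z N x = partition_function P S H N (disorder_seq \<omega> x)" for N x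
  have liminf_d: "liminf (\<lambda>N. log_rate N (d N)) = 0"
    using lim_imp_Liminf[OF _ D_rate] by (simp add: d_def)
  have d_le_Z: "d N \<le> Z N x" if "0 < N" "x \<in> space Q" for N x
    unfolding d_def Z_def using that
    by (intro emeasure_le_partition_function D_zero seq_space) auto
  have annealed: "annealed_free_energy Q \<omega> P S H = liminf (\<lambda>N. log_rate N (\<integral>\<^sup>+ x. Z N x \<partial>Q))"
    by (simp add: annealed_free_energy_def Z_def)
  have "ennreal (exp (0 + real N * 0)) * d N \<le> (\<integral>\<^sup>+ x. Z N x \<partial>Q)" if "0 < N" for N
  proof -
    have "d N = (\<integral>\<^sup>+ x. d N \<partial>Q)" by (simp add: Q.emeasure_space_1)
    also have "\<dots> \<le> (\<integral>\<^sup>+ x. Z N x \<partial>Q)" by (intro nn_integral_mono d_le_Z that)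
    finally show ?thesis by simp
  qed
  from liminf_log_rate_ge[OF this]
  have nonneg: "0 \<le> annealed_free_energy Q \<omega> P S H"
    by (simp add: annealed liminf_d flip: zero_ereal_def)
  have "0 < liminf (\<lambda>N. log_rate N (\<integral>\<^sup>+ z.
          exp_ereal (H N (disorder_seq \<omega> (fst z)) (trajectory S (snd z)) +
            ereal (\<Sum>n=0..N. F (disorder_shift n (disorder_seq \<omega> (fst z))))) \<partial>(Q \<Otimes>\<^sub>M P)))"
    if pos: "0 < annealed_free_energy Q \<omega> P S H"
      and F_local: "local_function \<Gamma> F"
      and F_bounded: "bounded (F ` space (disorder_space \<Gamma>))"
      and F_measurable: "F \<in> borel_measurable (disorder_space \<Gamma>)"
      and F_centered: "(\<integral>x. F (disorder_seq \<omega> x) \<partial>Q) = 0"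
    for F :: "(nat \<Rightarrow> real) \<Rightarrow> real"
  proof -
    let ?\<mu> = "distr Q (restrict_space borel \<Gamma>) (\<omega> 1)"
    interpret iid_sequence ?\<mu>
      by (rule iid_sequence.intro[OF prob_space_distr_disorder[OF assms(2)]])
    have sets_law: "sets law = sets (disorder_space \<Gamma>)"
      unfolding disorder_space_def by (intro sets_PiM_cong) auto
    note space_law = sets_eq_imp_space_eq[OF sets_law]
    note distr_seq = distr_disorder_seq[OF assms(2)]
    obtain J where J: "finite J" "J \<subseteq> {1..}" and F_J: "\<And>w w'. w \<in> space (disorder_space \<Gamma>) \<Longrightarrow>
        w' \<in> space (disorder_space \<Gamma>) \<Longrightarrow> (\<And>j. j \<in> J \<Longrightarrow> w j = w' j) \<Longrightarrow> F w = F w'"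
      using F_local unfolding local_function_def by metis
    obtain k where "\<forall>j\<in>J. j \<le> k"
      using J(1) finite_nat_set_iff_bounded_le by auto
    with J(2) have k: "J \<subseteq> {1..k}" by auto
    obtain B where B: "\<And>w. w \<in> space (disorder_space \<Gamma>) \<Longrightarrow> \<bar>F w\<bar> \<le> B"
      using F_bounded unfolding bounded_iff by auto
    interpret local_observable ?\<mu> F k B
    proof
      show "F \<in> borel_measurable law"
        using F_measurable measurable_cong_sets[OF sets_law refl] by blast
      show "F x = F y" if "x \<in> space law" "y \<in> space law" "\<And>j. j \<in> {1..k} \<Longrightarrow> x j = y j" for x y
        using that k by (intro F_J) (auto simp: space_law)
      show "\<bar>F x\<bar> \<le> B" if "x \<in> space law" for x
        using that B by (simp add: space_law)
      show "(\<integral>x. F x \<partial>law) = 0"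
        using F_centered F_measurable by (simp add: integral_distr flip: distr_seq)
    qed
    have T_measurable: "birkhoff_sum n \<in> borel_measurable (disorder_space \<Gamma>)" for n
      using measurable_birkhoff_sum measurable_cong_sets[OF sets_law refl] by blast
    define W where "W N = (\<integral>\<^sup>+ x. Z N x * ennreal (exp (birkhoff_sum (Suc N) (disorder_seq \<omega> x))) \<partial>Q)" for N
    have W: "(\<integral>\<^sup>+ z. exp_ereal (H N (disorder_seq \<omega> (fst z)) (trajectory S (snd z)) +
            ereal (\<Sum>n=0..N. F (disorder_shift n (disorder_seq \<omega> (fst z))))) \<partial>(Q \<Otimes>\<^sub>M P)) = W N"
      if "0 < N" for N
    proof -
      from nn_integral_exp_ereal_add[of P S \<omega> Q \<Gamma> H N "birkhoff_sum (Suc N)", OF assms(1)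
          measurable_disorder_seq[OF assms(2)] H_measurable[OF that] T_measurable]
      show ?thesis
        by (simp only: W_def Z_def birkhoff_sum_def lessThan_Suc_atMost atLeast0AtMost)
    qed
    have ge: "ereal l + liminf (\<lambda>N. log_rate N (z N))
        \<le> liminf (\<lambda>N. log_rate N (\<integral>\<^sup>+ z.
          exp_ereal (H N (disorder_seq \<omega> (fst z)) (trajectory S (snd z)) +
            ereal (\<Sum>n=0..N. F (disorder_shift n (disorder_seq \<omega> (fst z))))) \<partial>(Q \<Otimes>\<^sub>M P)))"
      if "\<And>N. 0 < N \<Longrightarrow> ennreal (exp (C + real N * l)) * z N \<le> W N" for C l z
      using that by (intro liminf_log_rate_ge) (simp only: W)
    show ?thesis
    proof (cases rule: birkhoff_sum_dichotomy)
      case (growth l C)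
      (* The sum has N + 1 terms: hence the shift of C by l. *)
      have "ennreal (exp ((C + l) + real N * l)) * d N \<le> W N" if N: "0 < N" for N
      proof -
        have "ennreal (exp ((C + l) + real N * l)) * d N
            \<le> d N * (\<integral>\<^sup>+ x. ennreal (exp (birkhoff_sum (Suc N) x)) \<partial>law)"
          using growth(2)[of "Suc N"]
          by (subst mult.commute) (intro mult_left_mono, auto simp: algebra_simps)
        also have "\<dots> = d N * (\<integral>\<^sup>+ x. ennreal (exp (birkhoff_sum (Suc N) (disorder_seq \<omega> x))) \<partial>Q)"
          using T_measurable by (subst distr_seq[symmetric]) (simp add: nn_integral_distr)
        also have "\<dots> = (\<integral>\<^sup>+ x. d N * ennreal (exp (birkhoff_sum (Suc N) (disorder_seq \<omega> x))) \<partial>Q)"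
          using measurable_compose[OF measurable_disorder_seq[OF assms(2)] T_measurable]
          by (subst nn_integral_cmult) auto
        also have "\<dots> \<le> W N"
          unfolding W_def by (intro nn_integral_mono mult_right_mono d_le_Z N) auto
        finally show ?thesis .
      qed
      from ge[OF this] growth(1) show ?thesis
        by (simp add: liminf_d less_le_trans[of 0 "ereal l"])
    next
      case (bounded_below C)
      have "ennreal (exp (C + real N * 0)) * (\<integral>\<^sup>+ x. Z N x \<partial>Q) \<le> W N" if "0 < N" for N
      proof -
        have "AE w in distr Q (disorder_space \<Gamma>) (disorder_seq \<omega>). C \<le> birkhoff_sum (Suc N) w"
          unfolding distr_seq by (rule bounded_below)
        then have "AE x in Q. C \<le> birkhoff_sum (Suc N) (disorder_seq \<omega> x)"
          by (rule AE_distrD[rotated]) measurable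
        then have "AE x in Q. ennreal (exp C) * Z N x
            \<le> Z N x * ennreal (exp (birkhoff_sum (Suc N) (disorder_seq \<omega> x)))"
          by eventually_elim (subst mult.commute, intro mult_left_mono, auto)
        then have "(\<integral>\<^sup>+ x. ennreal (exp C) * Z N x \<partial>Q) \<le> W N"
          unfolding W_def by (rule nn_integral_mono_AE)
        moreover have "Z N \<in> borel_measurable Q"
          unfolding Z_def using that
          by (intro measurable_partition_function[OF assms(1) measurable_disorder_seq[OF assms(2)]]
              H_measurable)
        ultimately show ?thesis by (simp add: nn_integral_cmult)
      qed
      from ge[OF this] pos show ?thesis by (simp add: annealed flip: zero_ereal_def)
    qed
  qed
  with nonneg show ?thesis by blast
qed

end
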